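(* There is an absolute constant $k>0$ such that the following holds. Let $T:C[0,1]\to C[0,1]$ be a positive linear operator such that $T(e_0)=e_0$, $T(e_1;x)=x$ for all $x\in[0,1]$, and such that there is a function $T^\infty(e_2)\in C[0,1]$ with $$\lim_{m\to\infty}\|T^m(e_2)-T^\infty(e_2)\|=0.$$ Then there exists a positive linear operator $T^\infty:C[0,1]\to C[0,1]$ (whose value at $e_2$ is the uniform limit of $T^m(e_2)$ as $m\to\infty$) such that for all $m\in\mathbb{N}$, $x\in[0,1]$ and $f\in C[0,1]$, $$|(T^m-T^\infty)(f;x)|\le k\,\omega_2\Bigl(f,\tfrac12\sqrt{|(T^\infty-T^m)(e_2;x)|}\Bigr).$$
   Context: $C[0,1]$ is the space of real-valued continuous functions on $[0,1]$ with the supremum norm $\|\cdot\|$. A linear operator $T:C[0,1]\to C[0,1]$ is positive if $f\ge 0$ implies $T(f)\ge 0$. $T(f;x)$ denotes the value of $T(f)$ at $x$, and $T^m$ is the $m$-fold composition (iterate) of $T$. $e_i(x)=x^i$ for $i=0,1,2$. The second modulus of smoothness of $f\in C[0,1]$ is $\omega_2(f,t)=\sup_{0<h\le t}\ \sup_{0\le x\le 1-2h}|f(x+2h)-2f(x+h)+f(x)|$ for $t\ge 0$, with the convention that a supremum over an empty set is $0$ (so only $h\le 1/2$ contributes, and $\omega_2(f,0)=0$). "Absolute constant" means independent of $T$, $m$, $x$ and $f$. *)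

theory Defs
  imports "HOL-Analysis.Analysis"
begin

text \<open>
  The interval $[0,1]$ as a metric space of its own, so that \<open>unit_interval \<Rightarrow>\<^sub>C real\<close> is
  $C[0,1]$ with the supremum norm. Boundedness, built into \<open>\<Rightarrow>\<^sub>C\<close>, is automatic by compactness;
  see \<open>bcontfun_unit_interval\<close>.
\<close>

typedef unit_interval = "{0..1::real}"
  morphisms coord point
  by auto

setup_lifting type_definition_unit_interval

instantiation unit_interval :: metric_space
begin

lift_definition dist_unit_interval :: "unit_interval \<Rightarrow> unit_interval \<Rightarrow> real" is dist .

definition uniformity_unit_interval :: "(unit_interval \<times> unit_interval) filter"
  where "uniformity_unit_interval = (INF e\<in>{0<..}. principal {(x, y). dist x y < e})"

definition open_unit_interval :: "unit_interval set \<Rightarrow> bool"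
  where "open_unit_interval S \<longleftrightarrow> (\<forall>x\<in>S. \<forall>\<^sub>F (x', y) in uniformity. x' = x \<longrightarrow> y \<in> S)"

instance
proof
  fix x y z :: unit_interval
  show "dist x y = 0 \<longleftrightarrow> x = y"
    by transfer simp
  show "dist x y \<le> dist x z + dist y z"
    by transfer (rule dist_triangle2)
qed (rule uniformity_unit_interval_def open_unit_interval_def)+

end

lemma continuous_on_coord: "continuous_on S coord"
  unfolding continuous_on_iff dist_unit_interval.rep_eq by blast

lemma continuous_on_point: "continuous_on {0..1} point"
  unfolding continuous_on_iff dist_unit_interval.rep_eq
  by (auto simp: point_inverse)

lemma compact_UNIV_unit_interval: "compact (UNIV :: unit_interval set)"
proof -
  have "UNIV = point ` {0..1}"
    using type_definition.Abs_image[OF type_definition_unit_interval] by simp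
  then show ?thesis
    using compact_continuous_image[OF continuous_on_point compact_Icc] by simp
qed

lemma bcontfun_unit_interval:
  "(bcontfun :: (unit_interval \<Rightarrow> real) set) = {f. continuous_on UNIV f}"
  unfolding bcontfun_def
  using compact_continuous_image[OF _ compact_UNIV_unit_interval] compact_imp_bounded by blast

lemma continuous_on_comp_coord_iff:
  fixes g :: "real \<Rightarrow> real"
  shows "continuous_on UNIV (\<lambda>u. g (coord u)) \<longleftrightarrow> continuous_on {0..1} g"
proof
  assume "continuous_on UNIV (\<lambda>u. g (coord u))"
  then have "continuous_on {0..1} (\<lambda>x. g (coord (point x)))"
    by (rule continuous_on_compose2[OF _ continuous_on_point]) simp
  then show "continuous_on {0..1} g"
    by (rule continuous_on_eq) (simp add: point_inverse)
next
  assume "continuous_on {0..1} g"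
  then show "continuous_on UNIV (\<lambda>u. g (coord u))"
    by (rule continuous_on_compose2[OF _ continuous_on_coord]) (use coord in auto)
qed

definition e_fun :: "nat \<Rightarrow> unit_interval \<Rightarrow>\<^sub>C real"
  where "e_fun i = Bcontfun (\<lambda>x. coord x ^ i)"

lemma e_fun_apply [simp]: "e_fun i x = coord x ^ i"
  unfolding e_fun_def
  by (subst Bcontfun_inverse)
    (simp_all add: bcontfun_unit_interval continuous_on_power continuous_on_coord)

definition positive_op :: "((unit_interval \<Rightarrow>\<^sub>C real) \<Rightarrow> (unit_interval \<Rightarrow>\<^sub>C real)) \<Rightarrow> bool"
  where "positive_op T \<longleftrightarrow> (\<forall>f. (\<forall>x. 0 \<le> apply_bcontfun f x) \<longrightarrow> (\<forall>x. 0 \<le> T f x))"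

text \<open>
  The element \<open>0\<close> implements the convention that a supremum over an empty set is $0$; it changes
  nothing otherwise, the remaining elements being nonnegative. \<open>point\<close> is only applied within
  $[0,1]$.
\<close>

definition omega2 :: "(unit_interval \<Rightarrow>\<^sub>C real) \<Rightarrow> real \<Rightarrow> real"
  where "omega2 f t = Sup (insert 0
    {\<bar>f (point (x + 2 * h)) - 2 * f (point (x + h)) + f (point x)\<bar> | x h.
      0 < h \<and> h \<le> t \<and> 0 \<le> x \<and> x \<le> 1 - 2 * h})"

end

theory Submission
  imports Defs
begin

text \<open>
  A positive operator \<open>T\<close> that reproduces affine functions satisfies \<open>T u \<ge> u\<close> for every function \<open>u\<close>
  that has a supporting line at each point (\<open>jensen\<close>): apply \<open>T\<close> to \<open>u \<ge> line\<close> and evaluate at the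
  point of contact. Hence \<open>T\<^sup>m u\<close> increases with \<open>m\<close>. If both \<open>K e\<^sub>2 + g\<close> and \<open>K e\<^sub>2 - g\<close> are of
  this kind, which is a way of saying that \<open>g\<close> has second derivative at most \<open>2 K\<close> in absolute
  value, the monotonicity of both sequences gives, for \<open>m \<le> p\<close>,
  \<open>\<bar>T\<^sup>p g - T\<^sup>m g\<bar> \<le> K (T\<^sup>p e\<^sub>2 - T\<^sup>m e\<^sub>2)\<close>. So the convergence on \<open>e\<^sub>2\<close> controls the convergence on
  all smooth functions, pointwise and with a rate.

  An arbitrary \<open>f\<close> is first replaced by a smooth \<open>g\<close> with \<open>\<bar>f - g\<bar> \<le> 9/8 \<omega>\<^sub>2(f,h)\<close> for which
  \<open>K = 2 \<omega>\<^sub>2(f,h) / h\<^sup>2\<close> is admissible (\<open>smooth_approximation\<close>). The function \<open>g\<close> comes from the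
  polygon through the values of \<open>f\<close> at equidistant nodes, whose corners are rounded off by
  parabolic arcs. The polygon turns at a node by the second difference of \<open>f\<close> there, so the
  curvature is controlled; and the polygon stays close to \<open>f\<close> because a function that vanishes at
  the ends of an interval is bounded by its second differences
  (\<open>bound_of_second_differences\<close>). No values of \<open>f\<close> outside \<open>[0,1]\<close> enter, since the two outer
  pieces of the polygon can be continued as straight lines.

  Contractivity of the iterates turns this into
  \<open>\<bar>T\<^sup>p f - T\<^sup>m f\<bar> \<le> \<omega>\<^sub>2(f,h) (9/4 + 2/h\<^sup>2 (T\<^sup>p e\<^sub>2 - T\<^sup>m e\<^sub>2))\<close> for \<open>0 < h \<le> 1\<close>
  (\<open>iterates_estimate\<close>). As \<open>\<omega>\<^sub>2(f,h) \<rightarrow> 0\<close>, the iterates of every \<open>f\<close> form a Cauchy sequence; their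
  limit is the required operator, and the estimate passes to \<open>p \<rightarrow> \<infinity>\<close>. At a point \<open>x\<close> where
  \<open>a = T\<^sup>\<infinity> e\<^sub>2 - T\<^sup>m e\<^sub>2\<close> is positive, the choice \<open>h = \<surd>a / 2\<close> gives the constant
  \<open>9/4 + 8 = 41/4\<close>; where \<open>a = 0\<close>, letting \<open>h \<rightarrow> 0\<close> shows that \<open>T\<^sup>m f\<close> and \<open>T\<^sup>\<infinity> f\<close> agree.
\<close>

section \<open>Supporting lines\<close>

text \<open>
  On the real line this is convexity. The supporting line itself is what a positive operator can be
  applied to, and for functions on the whole line it also exists at the endpoints \<open>0\<close> and \<open>1\<close>,
  where a convex function on \<open>[0,1]\<close> need not have one.
\<close>

definition supporting_lines :: "(real \<Rightarrow> real) \<Rightarrow> bool"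
  where "supporting_lines u \<longleftrightarrow> (\<forall>a. \<exists>s. \<forall>b. u a + s * (b - a) \<le> u b)"

lemma supporting_lines_affine: "supporting_lines (\<lambda>x. \<alpha> + \<beta> * x)"
  unfolding supporting_lines_def by (intro allI exI[of _ \<beta>]) (simp add: algebra_simps)

lemma supporting_lines_square: "supporting_lines (\<lambda>x. x\<^sup>2)"
  unfolding supporting_lines_def
proof (intro allI exI)
  fix a b :: real
  have "0 \<le> (b - a)\<^sup>2" by simp
  then show "a\<^sup>2 + 2 * a * (b - a) \<le> b\<^sup>2" by (simp add: power2_eq_square algebra_simps)
qed

lemma supporting_lines_add:
  assumes "supporting_lines u" "supporting_lines v"
  shows "supporting_lines (\<lambda>x. u x + v x)"
  unfolding supporting_lines_def
proof
  fix a
  obtain s t where st: "\<And>b. u a + s * (b - a) \<le> u b" "\<And>b. v a + t * (b - a) \<le> v b"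
    using assms unfolding supporting_lines_def by meson
  have "u a + v a + (s + t) * (b - a) \<le> u b + v b" for b
    using add_mono[OF st, of b b] by (simp add: algebra_simps)
  then show "\<exists>s. \<forall>b. u a + v a + s * (b - a) \<le> u b + v b" by blast
qed

lemma supporting_lines_scale:
  assumes "supporting_lines u" "0 \<le> c"
  shows "supporting_lines (\<lambda>x. c * u x)"
  unfolding supporting_lines_def
proof
  fix a
  obtain s where "\<And>b. u a + s * (b - a) \<le> u b"
    using assms unfolding supporting_lines_def by meson
  then have "c * u a + (c * s) * (b - a) \<le> c * u b" for b
    using mult_left_mono[OF _ \<open>0 \<le> c\<close>, of "u a + s * (b - a)" "u b"]
    by (simp add: algebra_simps)
  then show "\<exists>s. \<forall>b. c * u a + s * (b - a) \<le> c * u b" by blast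
qed

lemma supporting_lines_sum:
  assumes "\<And>i. i \<in> I \<Longrightarrow> supporting_lines (u i)"
  shows "supporting_lines (\<lambda>x. \<Sum>i\<in>I. u i x)"
  using assms
proof (induction I rule: infinite_finite_induct)
  case (insert i I)
  then show ?case by (simp add: supporting_lines_add)
qed (use supporting_lines_affine[of 0 0] in simp_all)

lemma supporting_lines_compose_affine:
  assumes "supporting_lines u"
  shows "supporting_lines (\<lambda>x. u (\<alpha> + \<beta> * x))"
  unfolding supporting_lines_def
proof
  fix a
  obtain s where "\<And>b. u (\<alpha> + \<beta> * a) + s * (b - (\<alpha> + \<beta> * a)) \<le> u b"
    using assms unfolding supporting_lines_def by meson
  then have "u (\<alpha> + \<beta> * a) + (s * \<beta>) * (b - a) \<le> u (\<alpha> + \<beta> * b)" for b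
    by (metis (no_types, opaque_lifting) add_diff_cancel_left mult.assoc right_diff_distrib)
  then show "\<exists>s. \<forall>b. u (\<alpha> + \<beta> * a) + s * (b - a) \<le> u (\<alpha> + \<beta> * b)" by blast
qed

section \<open>A quadratic spline approximation\<close>

definition half_square :: "real \<Rightarrow> real"
  where "half_square t = (max 0 t)\<^sup>2 / 2"

text \<open>
  This is \<open>max 0 t\<close> with its corner replaced by a parabola on \<open>[-1/2, 1/2]\<close>. Being a difference of
  two shifts of one function, it telescopes when summed over integer shifts.
\<close>

definition smooth_ramp :: "real \<Rightarrow> real"
  where "smooth_ramp t = half_square (t + 1/2) - half_square (t - 1/2)"

lemma half_square_nonpos: "t \<le> 0 \<Longrightarrow> half_square t = 0"
  and half_square_nonneg: "0 \<le> t \<Longrightarrow> half_square t = t\<^sup>2 / 2"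
  by (simp_all add: half_square_def)

lemma smooth_ramp_left: "t \<le> -1/2 \<Longrightarrow> smooth_ramp t = 0"
  and smooth_ramp_mid: "-1/2 \<le> t \<Longrightarrow> t \<le> 1/2 \<Longrightarrow> smooth_ramp t = (t + 1/2)\<^sup>2 / 2"
  and smooth_ramp_right: "1/2 \<le> t \<Longrightarrow> smooth_ramp t = t"
  by (simp_all add: smooth_ramp_def half_square_nonpos half_square_nonneg)
    (simp add: power2_eq_square field_simps)

lemma supporting_lines_half_square: "supporting_lines half_square"
  unfolding supporting_lines_def
proof (intro allI exI)
  fix a b :: real
  have *: "0 \<le> (max 0 b - max 0 a)\<^sup>2" by simp
  have "max 0 a * b \<le> max 0 a * max 0 b"
    by (rule mult_left_mono) auto
  moreover have "max 0 a * a = (max 0 a)\<^sup>2"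
    by (auto simp: max_def power2_eq_square)
  ultimately show "half_square a + max 0 a * (b - a) \<le> half_square b"
    using * unfolding half_square_def by (simp add: power2_diff algebra_simps)
qed

text \<open>
  The smooth ramp is the supremum over slopes \<open>s \<in> [0,1]\<close> of the lines
  \<open>s * (t + 1/2) - s\<^sup>2 / 2\<close>, so its supporting lines can be read off: they are the lines for which
  the supremum is attained.
\<close>

lemma smooth_ramp_ge_line:
  assumes "0 \<le> s" "s \<le> 1"
  shows "s * (t + 1/2) - s\<^sup>2 / 2 \<le> smooth_ramp t"
proof -
  consider "t \<le> -1/2" | "-1/2 \<le> t" "t \<le> 1/2" | "1/2 \<le> t" by linarith
  then show ?thesis
  proof cases
    case 1
    then have "s * (t + 1/2) \<le> 0" using assms by (simp add: mult_nonneg_nonpos)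
    moreover have "0 \<le> s\<^sup>2" by simp
    ultimately show ?thesis unfolding smooth_ramp_left[OF 1] by linarith
  next
    case 2
    have "0 \<le> (t + 1/2 - s)\<^sup>2" by simp
    then have "s * (t + 1/2) - s\<^sup>2 / 2 \<le> (t + 1/2)\<^sup>2 / 2"
      unfolding power2_diff by (simp add: algebra_simps)
    then show ?thesis unfolding smooth_ramp_mid[OF 2] .
  next
    case 3
    have "0 \<le> (1 - s) * (t - 1/2) + (1 - s)\<^sup>2 / 2" using assms 3 by auto
    also have "\<dots> = t - (s * (t + 1/2) - s\<^sup>2 / 2)"
      by (simp add: power2_eq_square field_simps)
    finally show ?thesis unfolding smooth_ramp_right[OF 3] by simp
  qed
qed

lemma smooth_ramp_eq_line:
  obtains s where "0 \<le> s" "s \<le> 1" "smooth_ramp t = s * (t + 1/2) - s\<^sup>2 / 2"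
proof -
  consider "t \<le> -1/2" | "-1/2 \<le> t" "t \<le> 1/2" | "1/2 \<le> t" by linarith
  then show ?thesis
  proof cases
    case 1
    then show ?thesis using that[of 0] by (simp add: smooth_ramp_left)
  next
    case 2
    then show ?thesis
      using that[of "t + 1/2"] by (simp add: smooth_ramp_mid power2_eq_square)
  next
    case 3
    then show ?thesis using that[of 1] by (simp add: smooth_ramp_right)
  qed
qed

lemma supporting_lines_smooth_ramp: "supporting_lines smooth_ramp"
  unfolding supporting_lines_def
proof
  fix a
  obtain s where s: "0 \<le> s" "s \<le> 1" "smooth_ramp a = s * (a + 1/2) - s\<^sup>2 / 2"
    by (rule smooth_ramp_eq_line)
  have "smooth_ramp a + s * (b - a) \<le> smooth_ramp b" for b
    using smooth_ramp_ge_line[OF s(1,2), of b] s(3) by (simp add: algebra_simps)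
  then show "\<exists>s. \<forall>b. smooth_ramp a + s * (b - a) \<le> smooth_ramp b" by blast
qed

lemma sum_smooth_ramp:
  assumes "n \<ge> 1"
  shows "(\<Sum>i=1..<n. smooth_ramp (y - real i)) = half_square (y - 1/2) - half_square (y - real n + 1/2)"
  using assms
  by (induction n rule: dec_induct) (simp_all add: smooth_ramp_def algebra_simps)

text \<open>
  The second derivative of the sum is at most \<open>1\<close>, the arcs at consecutive nodes being adjacent but
  not overlapping. After telescoping, the difference is explicitly an affine function plus two
  half squares.
\<close>

lemma supporting_lines_square_minus_ramps:
  assumes "n \<ge> 1"
  shows "supporting_lines (\<lambda>y. y\<^sup>2 / 2 - (\<Sum>i=1..<n. smooth_ramp (y - real i)))"
proof -
  have eq: "y\<^sup>2 / 2 - (\<Sum>i=1..<n. smooth_ramp (y - real i)) =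
      (-1/8 + 1/2 * y) + (half_square (1/2 + (-1) * y) + half_square ((1/2 - real n) + 1 * y))" for y
  proof -
    have "half_square (y - 1/2) + half_square (1/2 - y) = (y - 1/2)\<^sup>2 / 2"
      by (cases "y \<le> 1/2") (simp_all add: half_square_nonpos half_square_nonneg power2_commute)
    also have "\<dots> = y\<^sup>2 / 2 - y / 2 + 1/8"
      by (simp add: power2_eq_square field_simps)
    finally show ?thesis
      unfolding sum_smooth_ramp[OF assms] by (simp add: algebra_simps)
  qed
  show ?thesis
    unfolding eq
    by (rule supporting_lines_add[OF supporting_lines_affine supporting_lines_add[OF
      supporting_lines_compose_affine[OF supporting_lines_half_square]
      supporting_lines_compose_affine[OF supporting_lines_half_square]]])
qed

lemma smooth_ramp_minus_ramp:
  "\<bar>smooth_ramp t - max 0 t\<bar> \<le> (if \<bar>t\<bar> < 1/2 then 1/8 else 0)"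
proof -
  consider "t \<le> -1/2" | "1/2 \<le> t" | "\<bar>t\<bar> < 1/2" by linarith
  then show ?thesis
  proof cases
    case 3
    then have "smooth_ramp t - max 0 t = (1/2 - \<bar>t\<bar>)\<^sup>2 / 2"
      by (cases "0 \<le> t") (simp_all add: smooth_ramp_mid power2_eq_square field_simps)
    moreover have "(1/2 - \<bar>t\<bar>)\<^sup>2 \<le> (1/2)\<^sup>2" using 3 by (intro power_mono) auto
    moreover have "(1/2)\<^sup>2 = (1/4 :: real)" by (simp add: power2_eq_square)
    moreover have "0 \<le> (1/2 - \<bar>t\<bar>)\<^sup>2" by simp
    ultimately have "\<bar>smooth_ramp t - max 0 t\<bar> \<le> 1/8" by linarith
    then show ?thesis using 3 by simp
  qed (auto simp: smooth_ramp_left smooth_ramp_right)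
qed

text \<open>
  Rounding off moves the ramp only at distance less than \<open>1/2\<close> from its corner, so that at most the
  summand with the integer nearest to \<open>y\<close> is nonzero. This keeps the error independent of \<open>n\<close>.
\<close>

lemma sum_smooth_ramp_minus_ramp:
  "(\<Sum>i=1..<n. \<bar>smooth_ramp (y - real i) - max 0 (y - real i)\<bar>) \<le> 1/8"
proof -
  have "(\<Sum>i=1..<n. \<bar>smooth_ramp (y - real i) - max 0 (y - real i)\<bar>)
      \<le> (\<Sum>i=1..<n. if i = nat (round y) then 1/8 else 0)"
  proof (rule sum_mono)
    fix i
    have "i = nat (round y)" if "\<bar>y - real i\<bar> < 1/2"
      using round_unique'[of y "int i"] that by simp
    then have "(if \<bar>y - real i\<bar> < 1/2 then 1/8 else 0) \<le> (if i = nat (round y) then 1/8 else (0::real))"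
      by (cases "\<bar>y - real i\<bar> < 1/2") simp_all
    with smooth_ramp_minus_ramp[of "y - real i"]
    show "\<bar>smooth_ramp (y - real i) - max 0 (y - real i)\<bar>
        \<le> (if i = nat (round y) then 1/8 else 0)"
      by (rule order_trans)
  qed
  also have "\<dots> \<le> 1/8" by simp
  finally show ?thesis .
qed

definition second_diff :: "(nat \<Rightarrow> real) \<Rightarrow> nat \<Rightarrow> real"
  where "second_diff F i = F (i + 1) - 2 * F i + F (i - 1)"

text \<open>
  The variable \<open>y\<close> is scaled so that the nodes are the integers. Writing the polygonal interpolant
  as a sum of ramps, one for each corner, allows the corners to be rounded off by replacing each
  ramp with a smooth one.
\<close>

definition polygon :: "(nat \<Rightarrow> real) \<Rightarrow> nat \<Rightarrow> real \<Rightarrow> real"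
  where "polygon F n y = F 0 + y * (F 1 - F 0) + (\<Sum>i=1..<n. second_diff F i * max 0 (y - real i))"

definition spline :: "(nat \<Rightarrow> real) \<Rightarrow> nat \<Rightarrow> real \<Rightarrow> real"
  where "spline F n y = F 0 + y * (F 1 - F 0) + (\<Sum>i=1..<n. second_diff F i * smooth_ramp (y - real i))"

text \<open>
  Passing from \<open>n\<close> to \<open>n + 1\<close> adds one ramp, which bends the last piece at \<open>n\<close> towards the next
  value and changes nothing to the left of \<open>n\<close>.
\<close>

lemma polygon_last:
  assumes "n \<ge> 1" "real n - 1 \<le> y"
  shows "polygon F n y = F (n - 1) + (y - (real n - 1)) * (F n - F (n - 1))"
  using assms
proof (induction n rule: dec_induct)
  case base
  then show ?case by (simp add: polygon_def)
next
  case (step n)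
  have "polygon F (Suc n) y = polygon F n y + second_diff F n * max 0 (y - real n)"
    using step by (simp add: polygon_def)
  then show ?case using step by (simp add: second_diff_def algebra_simps)
qed

lemma polygon_segment:
  assumes "j < n" "real j \<le> y" "y \<le> real j + 1"
  shows "polygon F n y = F j + (y - real j) * (F (j + 1) - F j)"
proof -
  have "Suc j \<le> n" using assms by simp
  then show ?thesis
  proof (induction n rule: dec_induct)
    case base
    then show ?case using polygon_last[of "Suc j" y F] assms by simp
  next
    case (step n)
    then have "real j + 1 \<le> real n" by linarith
    then have "max 0 (y - real n) = 0" using assms by simp
    then show ?case using step by (simp add: polygon_def)
  qed
qed

lemma spline_minus_polygon:
  assumes "\<And>i. 1 \<le> i \<Longrightarrow> i < n \<Longrightarrow> \<bar>second_diff F i\<bar> \<le> w" "0 \<le> w"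
  shows "\<bar>spline F n y - polygon F n y\<bar> \<le> w / 8"
proof -
  have "\<bar>spline F n y - polygon F n y\<bar> =
      \<bar>\<Sum>i=1..<n. second_diff F i * (smooth_ramp (y - real i) - max 0 (y - real i))\<bar>"
    by (simp add: spline_def polygon_def sum_subtractf right_diff_distrib)
  also have "\<dots> \<le> (\<Sum>i=1..<n. \<bar>second_diff F i * (smooth_ramp (y - real i) - max 0 (y - real i))\<bar>)"
    by (rule sum_abs)
  also have "\<dots> \<le> (\<Sum>i=1..<n. w * \<bar>smooth_ramp (y - real i) - max 0 (y - real i)\<bar>)"
    using assms by (intro sum_mono) (auto simp: abs_mult intro!: mult_right_mono)
  also have "\<dots> = w * (\<Sum>i=1..<n. \<bar>smooth_ramp (y - real i) - max 0 (y - real i)\<bar>)"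
    by (simp add: sum_distrib_left)
  also have "\<dots> \<le> w * (1/8)"
    by (rule mult_left_mono[OF sum_smooth_ramp_minus_ramp assms(2)])
  finally show ?thesis by simp
qed

text \<open>
  Up to an affine function, the sum splits into \<open>w\<close> times half the square minus all ramps, and the
  ramps with coefficients \<open>w + \<sigma> * second_diff F i\<close>, which are nonnegative.
\<close>

lemma supporting_lines_square_plus_spline:
  assumes "n \<ge> 1" "\<And>i. 1 \<le> i \<Longrightarrow> i < n \<Longrightarrow> \<bar>second_diff F i\<bar> \<le> w" "0 \<le> w" "\<bar>\<sigma>\<bar> = 1"
  shows "supporting_lines (\<lambda>y. w * (y\<^sup>2 / 2) + \<sigma> * spline F n y)"
proof -
  have eq: "w * (y\<^sup>2 / 2) + \<sigma> * spline F n y =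
      (\<sigma> * F 0 + (\<sigma> * (F 1 - F 0)) * y)
      + (w * (y\<^sup>2 / 2 - (\<Sum>i=1..<n. smooth_ramp (y - real i)))
      + (\<Sum>i=1..<n. (w + \<sigma> * second_diff F i) * smooth_ramp (- real i + 1 * y)))" for y
    by (simp add: spline_def algebra_simps sum_distrib_left sum.distrib)
  have nonneg: "0 \<le> w + \<sigma> * second_diff F i" if "i \<in> {1..<n}" for i
  proof -
    have "\<bar>\<sigma> * second_diff F i\<bar> \<le> w"
      using assms that by (simp add: abs_mult)
    then show ?thesis by linarith
  qed
  show ?thesis
    unfolding eq
    by (rule supporting_lines_add[OF supporting_lines_affine supporting_lines_add[OF
      supporting_lines_scale[OF supporting_lines_square_minus_ramps[OF assms(1)] assms(3)]
      supporting_lines_sum[OF supporting_lines_scale[OF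
        supporting_lines_compose_affine[OF supporting_lines_smooth_ramp] nonneg]]]])
qed

lemma continuous_on_spline: "continuous_on S (spline F n)"
  unfolding spline_def smooth_ramp_def half_square_def
  by (auto intro!: continuous_intros continuous_on_max)

text \<open>
  At a maximum point \<open>y\<close> of \<open>\<bar>u\<bar>\<close>, reflect the nearer endpoint, where \<open>u\<close> vanishes, in \<open>y\<close>. The
  second difference centred at \<open>y\<close> has absolute value at least \<open>2 \<bar>u y\<bar> - \<bar>u y\<bar>\<close>.
\<close>

lemma bound_of_second_differences:
  fixes u :: "real \<Rightarrow> real"
  assumes cont: "continuous_on {a..b} u" and ends: "u a = 0" "u b = 0" and "0 \<le> w"
    and diff: "\<And>s t. 0 < t \<Longrightarrow> a \<le> s \<Longrightarrow> s + 2 * t \<le> b \<Longrightarrow>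
      \<bar>u (s + 2 * t) - 2 * u (s + t) + u s\<bar> \<le> w"
    and x: "x \<in> {a..b}"
  shows "\<bar>u x\<bar> \<le> w"
proof -
  have "continuous_on {a..b} (\<lambda>y. \<bar>u y\<bar>)" using cont by (intro continuous_intros)
  then obtain y where y: "y \<in> {a..b}" and max: "\<And>z. z \<in> {a..b} \<Longrightarrow> \<bar>u z\<bar> \<le> \<bar>u y\<bar>"
    using continuous_attains_sup[of "{a..b}" "\<lambda>y. \<bar>u y\<bar>"] x by (metis compact_Icc empty_iff)
  have "\<bar>u y\<bar> \<le> w"
  proof (cases "y = a \<or> y = b")
    case True
    then show ?thesis using ends \<open>0 \<le> w\<close> by auto
  next
    case False
    show ?thesis
    proof (cases "y - a \<le> b - y")
      case True
      have "\<bar>u (a + 2 * (y - a)) - 2 * u (a + (y - a)) + u a\<bar> \<le> w"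
        using False True y by (intro diff) auto
      moreover have "\<bar>u (a + 2 * (y - a))\<bar> \<le> \<bar>u y\<bar>"
        using True y by (intro max) auto
      ultimately show ?thesis using ends by simp
    next
      case below: False
      have "\<bar>u ((2 * y - b) + 2 * (b - y)) - 2 * u ((2 * y - b) + (b - y)) + u (2 * y - b)\<bar> \<le> w"
        using False below y by (intro diff) auto
      moreover have "\<bar>u (2 * y - b)\<bar> \<le> \<bar>u y\<bar>"
        using below y by (intro max) auto
      ultimately show ?thesis using ends by simp
    qed
  qed
  then show ?thesis using max[OF x] by linarith
qed

text \<open>
  On each segment, subtracting the chord from \<open>f\<close> leaves the second differences unchanged and
  produces a function that vanishes at both ends.
\<close>

lemma polygon_error:
  fixes f :: "real \<Rightarrow> real"
  assumes cont: "continuous_on {0..1} f" and n: "n \<ge> 1" and "0 \<le> w"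
    and diff: "\<And>s t. 0 < t \<Longrightarrow> t \<le> 1 / real n \<Longrightarrow> 0 \<le> s \<Longrightarrow> s + 2 * t \<le> 1 \<Longrightarrow>
      \<bar>f (s + 2 * t) - 2 * f (s + t) + f s\<bar> \<le> w"
    and x: "x \<in> {0..1}"
  shows "\<bar>f x - polygon (\<lambda>i. f (real i / real n)) n (real n * x)\<bar> \<le> w"
proof -
  define F where "F = (\<lambda>i. f (real i / real n))"
  \<comment> \<open>The minimum puts the right endpoint \<open>x = 1\<close> into the last segment.\<close>
  define j where "j = min (nat \<lfloor>real n * x\<rfloor>) (n - 1)"
  have "j < n" using n by (simp add: j_def)
  have nx: "0 \<le> real n * x" "real n * x \<le> real n"
    using x n by (auto simp: mult_left_le)
  have j: "real j \<le> real n * x" "real n * x \<le> real j + 1"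
    using nx n unfolding j_def min_def by (auto simp: of_nat_diff) linarith+
  define a b where "a = real j / real n" and "b = (real j + 1) / real n"
  have n0: "real n > 0" using n by simp
  have ab: "0 \<le> a" "b \<le> 1" "b - a = 1 / real n" "x \<in> {a..b}"
    using \<open>j < n\<close> j n0 by (auto simp: a_def b_def field_simps)
  define u where "u z = f z - (F j + (real n * z - real j) * (F (j + 1) - F j))" for z
  have "\<bar>u x\<bar> \<le> w"
  proof (rule bound_of_second_differences[where u = u and a = a and b = b])
    show "continuous_on {a..b} u"
      unfolding u_def
      by (intro continuous_intros continuous_on_subset[OF cont]) (use ab in auto)
    show "u a = 0" "u b = 0"
      using n0 by (auto simp: u_def a_def b_def F_def field_simps)
    show "\<bar>u (s + 2 * t) - 2 * u (s + t) + u s\<bar> \<le> w"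
      if "0 < t" "a \<le> s" "s + 2 * t \<le> b" for s t
    proof -
      have "u (s + 2 * t) - 2 * u (s + t) + u s = f (s + 2 * t) - 2 * f (s + t) + f s"
        by (simp add: u_def algebra_simps)
      also have "\<bar>\<dots>\<bar> \<le> w"
        using that ab by (intro diff) auto
      finally show ?thesis .
    qed
  qed (use ab \<open>0 \<le> w\<close> in auto)
  then show ?thesis
    using polygon_segment[OF \<open>j < n\<close> j, of F] unfolding u_def F_def by simp
qed

section \<open>Approximation in terms of the second modulus of smoothness\<close>

definition restrict01 :: "(real \<Rightarrow> real) \<Rightarrow> unit_interval \<Rightarrow>\<^sub>C real"
  where "restrict01 u = Bcontfun (\<lambda>x. u (coord x))"

lemma restrict01_apply:
  assumes "continuous_on {0..1} u"
  shows "restrict01 u x = u (coord x)"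
  unfolding restrict01_def
  by (subst Bcontfun_inverse) (simp_all add: bcontfun_unit_interval continuous_on_comp_coord_iff assms)

lemma coord_bounds: "0 \<le> coord x" "coord x \<le> 1"
  using coord[of x] by auto

lemma abs_le_norm_bcontfun:
  fixes f :: "'a::topological_space \<Rightarrow>\<^sub>C real"
  shows "\<bar>f x\<bar> \<le> norm f"
  using norm_bounded[of f x] by simp

lemma omega2_bdd_above:
  fixes f :: "unit_interval \<Rightarrow>\<^sub>C real"
  shows "bdd_above (insert 0
    {\<bar>f (point (x + 2 * h)) - 2 * f (point (x + h)) + f (point x)\<bar> | x h.
      0 < h \<and> h \<le> t \<and> 0 \<le> x \<and> x \<le> 1 - 2 * h})"
proof (rule bdd_aboveI[of _ "4 * norm f"])
  fix y
  assume "y \<in> insert 0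
    {\<bar>f (point (x + 2 * h)) - 2 * f (point (x + h)) + f (point x)\<bar> | x h.
      0 < h \<and> h \<le> t \<and> 0 \<le> x \<and> x \<le> 1 - 2 * h}"
  then show "y \<le> 4 * norm f"
  proof
    assume "y \<in> {\<bar>f (point (x + 2 * h)) - 2 * f (point (x + h)) + f (point x)\<bar> | x h.
      0 < h \<and> h \<le> t \<and> 0 \<le> x \<and> x \<le> 1 - 2 * h}"
    then obtain x h where "y = \<bar>f (point (x + 2 * h)) - 2 * f (point (x + h)) + f (point x)\<bar>"
      by blast
    then show ?thesis
      using abs_le_norm_bcontfun[of f "point (x + 2 * h)"] abs_le_norm_bcontfun[of f "point (x + h)"]
        abs_le_norm_bcontfun[of f "point x"] by linarith
  qed simp
qed

lemma omega2_nonneg: "0 \<le> omega2 f t"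
  unfolding omega2_def by (rule cSup_upper[OF _ omega2_bdd_above]) simp

lemma second_difference_le_omega2:
  fixes f :: "unit_interval \<Rightarrow>\<^sub>C real"
  assumes "0 < h" "h \<le> t" "0 \<le> x" "x + 2 * h \<le> 1"
  shows "\<bar>f (point (x + 2 * h)) - 2 * f (point (x + h)) + f (point x)\<bar> \<le> omega2 f t"
  unfolding omega2_def
  by (rule cSup_upper[OF _ omega2_bdd_above], rule insertI2, rule CollectI, intro exI conjI, rule refl)
    (use assms in simp_all)

lemma omega2_small:
  fixes f :: "unit_interval \<Rightarrow>\<^sub>C real"
  assumes "0 < \<epsilon>"
  obtains h where "0 < h" "h \<le> 1" "omega2 f h \<le> \<epsilon>"
proof -
  have "uniformly_continuous_on UNIV f"
    by (intro compact_uniformly_continuous compact_UNIV_unit_interval) auto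
  then obtain d where d: "d > 0" "\<And>x y. dist y x < d \<Longrightarrow> dist (f y) (f x) < \<epsilon> / 2"
    using assms unfolding uniformly_continuous_on_def by (metis UNIV_I half_gt_zero)
  define h where "h = min 1 (d / 2)"
  have "omega2 f h \<le> \<epsilon>"
    unfolding omega2_def
  proof (rule cSup_least)
    fix y
    assume "y \<in> insert 0
      {\<bar>f (point (x + 2 * t)) - 2 * f (point (x + t)) + f (point x)\<bar> | x t.
        0 < t \<and> t \<le> h \<and> 0 \<le> x \<and> x \<le> 1 - 2 * t}"
    then show "y \<le> \<epsilon>"
    proof
      assume "y \<in> {\<bar>f (point (x + 2 * t)) - 2 * f (point (x + t)) + f (point x)\<bar> | x t.
        0 < t \<and> t \<le> h \<and> 0 \<le> x \<and> x \<le> 1 - 2 * t}"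
      then obtain x t where y: "y = \<bar>f (point (x + 2 * t)) - 2 * f (point (x + t)) + f (point x)\<bar>"
        and t: "0 < t" "t \<le> h" "0 \<le> x" "x \<le> 1 - 2 * t" by blast
      have "dist (point (x + 2 * t)) (point (x + t)) < d" "dist (point (x + t)) (point x) < d"
        using t d by (auto simp: dist_unit_interval.rep_eq point_inverse dist_real_def h_def)
      from this[THEN d(2)] show ?thesis
        unfolding y dist_real_def by linarith
    qed (use assms in simp)
  qed simp
  then show ?thesis using d that[of h] by (simp add: h_def)
qed

text \<open>
  Taking \<open>\<sigma> = 1\<close> and \<open>\<sigma> = -1\<close> in the last property bounds the second derivative of \<open>G\<close> by
  \<open>4 \<omega>\<^sub>2(f,h) / h\<^sup>2\<close> from both sides.
\<close>

lemma smooth_approximation: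
  fixes f :: "unit_interval \<Rightarrow>\<^sub>C real"
  assumes "0 < h" "h \<le> 1"
  obtains G where "continuous_on {0..1} G"
    and "\<And>x. \<bar>f x - restrict01 G x\<bar> \<le> 9/8 * omega2 f h"
    and "\<And>\<sigma>. \<bar>\<sigma>\<bar> = 1 \<Longrightarrow> supporting_lines (\<lambda>x. 2 * omega2 f h / h\<^sup>2 * x\<^sup>2 + \<sigma> * G x)"
proof -
  define w where "w = omega2 f h"
  have "0 \<le> w" by (simp add: w_def omega2_nonneg)
  \<comment> \<open>The mesh size \<open>1 / n\<close> lies between \<open>h / 2\<close> and \<open>h\<close>: fine enough for \<open>\<omega>\<^sub>2(f,h)\<close> to bound the
    second differences, coarse enough for a curvature of order \<open>1 / h\<^sup>2\<close>.\<close>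
  define n where "n = nat \<lceil>1 / h\<rceil>"
  have n: "1 / h \<le> real n" "real n \<le> 2 / h" "n \<ge> 1"
  proof -
    have "1 \<le> 1 / h" using assms by simp
    moreover have "2 / h = 1 / h + 1 / h" by simp
    ultimately show "1 / h \<le> real n" "real n \<le> 2 / h" "n \<ge> 1"
      unfolding n_def by linarith+
  qed
  define F where "F = (\<lambda>i. f (point (real i / real n)))"
  define G where "G x = spline F n (real n * x)" for x
  have step: "1 / real n \<le> h"
    using n assms by (simp add: field_simps)
  have diff: "\<bar>f (point (s + 2 * t)) - 2 * f (point (s + t)) + f (point s)\<bar> \<le> w"
    if "0 < t" "t \<le> 1 / real n" "0 \<le> s" "s + 2 * t \<le> 1" for s t
    unfolding w_def using that step by (intro second_difference_le_omega2) auto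
  have F: "\<bar>second_diff F i\<bar> \<le> w" if i: "1 \<le> i" "i < n" for i
  proof -
    have "\<bar>f (point (real (i - 1) / real n + 2 * (1 / real n)))
        - 2 * f (point (real (i - 1) / real n + 1 / real n)) + f (point (real (i - 1) / real n))\<bar> \<le> w"
      using i n by (intro diff) (auto simp: field_simps of_nat_diff)
    moreover have "real (i - 1) / real n + 2 * (1 / real n) = real (i + 1) / real n"
      "real (i - 1) / real n + 1 / real n = real i / real n"
      using i by (auto simp: field_simps of_nat_diff)
    ultimately show ?thesis by (simp add: second_diff_def F_def)
  qed
  have contG: "continuous_on {0..1} G"
    unfolding G_def
    by (rule continuous_on_compose2[OF continuous_on_spline[of UNIV]]) (auto intro!: continuous_intros)
  have contf: "continuous_on {0..1} (\<lambda>x. f (point x))"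
    by (rule continuous_on_compose2[OF _ continuous_on_point, of UNIV]) auto
  show ?thesis
  proof (rule that[of G])
    show "continuous_on {0..1} G" by (rule contG)
    show "\<bar>f x - restrict01 G x\<bar> \<le> 9/8 * omega2 f h" for x
    proof -
      have "\<bar>f (point (coord x)) - polygon F n (real n * coord x)\<bar> \<le> w"
        unfolding F_def
        by (rule polygon_error[where f = "\<lambda>x. f (point x)", OF contf n(3) \<open>0 \<le> w\<close> diff]) (use coord[of x] in auto)
      moreover have "\<bar>G (coord x) - polygon F n (real n * coord x)\<bar> \<le> w / 8"
        unfolding G_def by (rule spline_minus_polygon[OF F \<open>0 \<le> w\<close>])
      ultimately show ?thesis
        unfolding restrict01_apply[OF contG] coord_inverse w_def[symmetric] by linarith
    qed
    show "supporting_lines (\<lambda>x. 2 * omega2 f h / h\<^sup>2 * x\<^sup>2 + \<sigma> * G x)" if "\<bar>\<sigma>\<bar> = 1" for \<sigma>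
    proof -
      \<comment> \<open>The spline needs only the coefficient \<open>w n\<^sup>2 / 2\<close>; \<open>c\<close> is the excess.\<close>
      define c where "c = 2 * w / h\<^sup>2 - w * (real n)\<^sup>2 / 2"
      have "(real n)\<^sup>2 \<le> (2 / h)\<^sup>2" using n by (intro power_mono) auto
      then have "w * (real n)\<^sup>2 \<le> w * (4 / h\<^sup>2)"
        using \<open>0 \<le> w\<close> by (intro mult_left_mono) (auto simp: power_divide)
      then have "0 \<le> c" by (simp add: c_def mult.commute)
      have "supporting_lines (\<lambda>y. w * (y\<^sup>2 / 2) + \<sigma> * spline F n y)"
        using supporting_lines_square_plus_spline[OF n(3) F \<open>0 \<le> w\<close> that] .
      note supporting_lines_compose_affine[OF this, of 0 "real n"]
      from supporting_lines_add[OF supporting_lines_scale[OF supporting_lines_square \<open>0 \<le> c\<close>] this]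
      have "supporting_lines
          (\<lambda>x. c * x\<^sup>2 + (w * ((0 + real n * x)\<^sup>2 / 2) + \<sigma> * spline F n (0 + real n * x)))" .
      moreover have "c * x\<^sup>2 + (w * ((0 + real n * x)\<^sup>2 / 2) + \<sigma> * spline F n (0 + real n * x)) =
          2 * omega2 f h / h\<^sup>2 * x\<^sup>2 + \<sigma> * G x" for x
        unfolding c_def G_def w_def[symmetric] by (simp add: left_diff_distrib power_mult_distrib)
      ultimately show ?thesis by simp
    qed
  qed
qed

section \<open>Positive operators that reproduce affine functions\<close>

locale affine_reproducing =
  fixes T :: "(unit_interval \<Rightarrow>\<^sub>C real) \<Rightarrow> (unit_interval \<Rightarrow>\<^sub>C real)"
  assumes linear: "linear T" and positive: "positive_op T"
    and e0: "T (e_fun 0) = e_fun 0" and e1: "T (e_fun 1) = e_fun 1"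
begin

lemma mono:
  fixes f g :: "unit_interval \<Rightarrow>\<^sub>C real"
  assumes "\<And>y. apply_bcontfun f y \<le> g y"
  shows "T f x \<le> T g x"
proof -
  have "0 \<le> T (g - f) x"
    using positive assms unfolding positive_op_def by simp
  then show ?thesis by (simp add: linear_diff[OF linear])
qed

lemma abs_le:
  fixes f :: "unit_interval \<Rightarrow>\<^sub>C real"
  assumes "\<And>y. \<bar>apply_bcontfun f y\<bar> \<le> c"
  shows "\<bar>T f x\<bar> \<le> c"
proof -
  have f: "- c \<le> f y" "f y \<le> c" for y using assms[of y] by auto
  have "T f x \<le> T (c *\<^sub>R e_fun 0) x" by (rule mono) (use f in simp)
  moreover have "T ((- c) *\<^sub>R e_fun 0) x \<le> T f x" by (rule mono) (use f in simp)
  ultimately show ?thesis by (simp add: linear_neg[OF linear] linear_scale[OF linear] e0)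
qed

text \<open>
  \<open>T\<close> leaves the supporting line at \<open>coord x\<close> unchanged, and this line agrees with \<open>f\<close> at \<open>x\<close>.
\<close>

lemma jensen:
  fixes f :: "unit_interval \<Rightarrow>\<^sub>C real"
  assumes u: "supporting_lines u" and f: "\<And>y. f y = u (coord y)"
  shows "f x \<le> T f x"
proof -
  obtain s where s: "\<And>b. u (coord x) + s * (b - coord x) \<le> u b"
    using u unfolding supporting_lines_def by meson
  let ?l = "(u (coord x) - s * coord x) *\<^sub>R e_fun 0 + s *\<^sub>R e_fun 1"
  have "T ?l x \<le> T f x"
  proof (rule mono)
    show "?l y \<le> f y" for y
      using s[of "coord y"] by (simp add: f algebra_simps)
  qed
  moreover have "T ?l = ?l"
    by (simp only: linear_add[OF linear] linear_scale[OF linear] e0 e1)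
  ultimately show ?thesis by (simp add: f)
qed

lemma funpow: "affine_reproducing (T ^^ m)"
proof (induction m)
  case 0
  show ?case by (rule affine_reproducing.intro) (simp_all add: linear_iff positive_op_def)
next
  case (Suc m)
  interpret Tm: affine_reproducing "T ^^ m" by (rule Suc)
  show ?case
  proof (rule affine_reproducing.intro)
    show "linear (T ^^ Suc m)"
      using linear_compose[OF Tm.linear linear] by simp
    show "positive_op (T ^^ Suc m)"
      using positive Tm.positive by (simp add: positive_op_def)
  qed (simp_all only: funpow.simps comp_apply Tm.e0 Tm.e1 e0 e1)
qed

lemma iterates_mono:
  fixes f :: "unit_interval \<Rightarrow>\<^sub>C real"
  assumes "supporting_lines u" "\<And>y. f y = u (coord y)" "m \<le> p"
  shows "(T ^^ m) f x \<le> (T ^^ p) f x"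
  using \<open>m \<le> p\<close>
proof (induction p rule: dec_induct)
  case (step p)
  interpret Tp: affine_reproducing "T ^^ p" by (rule funpow)
  have "(T ^^ p) f x \<le> (T ^^ p) (T f) x"
    by (rule Tp.mono) (rule jensen[OF assms(1,2)])
  then show ?case using step by (simp add: funpow_swap1)
qed simp

text \<open>
  The differences \<open>T\<^sup>p (f - g)\<close> and \<open>T\<^sup>m (f - g)\<close> contribute at most \<open>9/8 \<omega>\<^sub>2(f,h)\<close> each, the smooth
  approximation \<open>g\<close> the rest.
\<close>

lemma iterates_estimate:
  assumes "m \<le> p" "0 < h" "h \<le> 1"
  shows "\<bar>(T ^^ p) f x - (T ^^ m) f x\<bar>
    \<le> omega2 f h * (9/4 + 2 / h\<^sup>2 * ((T ^^ p) (e_fun 2) x - (T ^^ m) (e_fun 2) x))"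
proof -
  interpret Tp: affine_reproducing "T ^^ p" by (rule funpow)
  interpret Tm: affine_reproducing "T ^^ m" by (rule funpow)
  define w where "w = omega2 f h"
  define E where "E = (T ^^ p) (e_fun 2) x - (T ^^ m) (e_fun 2) x"
  obtain G where G: "continuous_on {0..1} G"
    and fG: "\<And>x. \<bar>f x - restrict01 G x\<bar> \<le> 9/8 * w"
    and sup: "\<And>\<sigma>. \<bar>\<sigma>\<bar> = 1 \<Longrightarrow> supporting_lines (\<lambda>x. 2 * w / h\<^sup>2 * x\<^sup>2 + \<sigma> * G x)"
    using smooth_approximation[OF assms(2,3), of f, folded w_def] by blast
  let ?g = "restrict01 G"
  have 1: "\<bar>(T ^^ p) (f - ?g) x\<bar> \<le> 9/8 * w" "\<bar>(T ^^ m) (f - ?g) x\<bar> \<le> 9/8 * w"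
    by (rule Tp.abs_le, use fG in simp) (rule Tm.abs_le, use fG in simp)
  have 2: "0 \<le> 2 * w / h\<^sup>2 * E + \<sigma> * ((T ^^ p) ?g x - (T ^^ m) ?g x)" if "\<bar>\<sigma>\<bar> = 1" for \<sigma>
  proof -
    let ?c = "(2 * w / h\<^sup>2) *\<^sub>R e_fun 2 + \<sigma> *\<^sub>R ?g"
    have "(T ^^ m) ?c x \<le> (T ^^ p) ?c x"
      by (rule iterates_mono[OF sup[OF that] _ assms(1)]) (simp add: restrict01_apply[OF G])
    then show ?thesis
      by (simp add: Tp.linear Tm.linear linear_add linear_scale E_def algebra_simps)
  qed
  have "\<bar>(T ^^ p) ?g x - (T ^^ m) ?g x\<bar> \<le> 2 * w / h\<^sup>2 * E"
    using 2[of 1] 2[of "-1"] by simp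
  moreover have "(T ^^ p) f x = (T ^^ p) (f - ?g) x + (T ^^ p) ?g x"
    "(T ^^ m) f x = (T ^^ m) (f - ?g) x + (T ^^ m) ?g x"
    by (simp_all add: Tp.linear Tm.linear linear_diff)
  ultimately have "\<bar>(T ^^ p) f x - (T ^^ m) f x\<bar> \<le> 9/4 * w + 2 * w / h\<^sup>2 * E"
    using 1 by linarith
  also have "\<dots> = w * (9/4 + 2 / h\<^sup>2 * E)" by (simp add: algebra_simps)
  finally show ?thesis unfolding w_def E_def .
qed

text \<open>
  First fix \<open>h\<close> such that \<open>\<omega>\<^sub>2(f,h)\<close> is small, then take \<open>m\<close> and \<open>p\<close> so large that
  \<open>T\<^sup>p e\<^sub>2 - T\<^sup>m e\<^sub>2\<close> is small compared with \<open>h\<^sup>2\<close>.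
\<close>

lemma iterates_converge:
  assumes "convergent (\<lambda>m. (T ^^ m) (e_fun 2))"
  shows "convergent (\<lambda>m. (T ^^ m) f)"
proof (rule Cauchy_convergent)
  show "Cauchy (\<lambda>m. (T ^^ m) f)"
  proof (rule CauchyI')
    fix \<epsilon> :: real
    assume "0 < \<epsilon>"
    define \<delta> where "\<delta> = \<epsilon> / 4"
    have "0 < \<delta>" using \<open>0 < \<epsilon>\<close> by (simp add: \<delta>_def)
    then obtain h where h: "0 < h" "h \<le> 1" "omega2 f h \<le> \<delta>"
      using omega2_small by metis
    have "Cauchy (\<lambda>m. (T ^^ m) (e_fun 2))"
      using assms by (rule convergent_Cauchy)
    then obtain M where M: "\<And>p m. p \<ge> M \<Longrightarrow> m \<ge> M \<Longrightarrow>
        norm ((T ^^ p) (e_fun 2) - (T ^^ m) (e_fun 2)) < h\<^sup>2 / 4"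
      using CauchyD[of _ "h\<^sup>2 / 4"] h by (metis divide_pos_pos zero_less_numeral zero_less_power)
    have "norm ((T ^^ m) f - (T ^^ p) f) < \<epsilon>" if "m \<ge> M" "m < p" for m p
    proof -
      have "norm (((T ^^ m) f - (T ^^ p) f) x) \<le> \<delta> * 3" for x
      proof -
        define E where "E = (T ^^ p) (e_fun 2) x - (T ^^ m) (e_fun 2) x"
        have "E \<le> h\<^sup>2 / 4"
          using abs_le_norm_bcontfun[of "(T ^^ p) (e_fun 2) - (T ^^ m) (e_fun 2)" x] M[of p m] that
          by (simp add: E_def)
        then have "2 / h\<^sup>2 * E \<le> 2 / h\<^sup>2 * (h\<^sup>2 / 4)"
          using h by (intro mult_left_mono) auto
        also have "\<dots> = 1/2" using h by simp
        finally have "9/4 + 2 / h\<^sup>2 * E \<le> 3" by simp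
        then have "omega2 f h * (9/4 + 2 / h\<^sup>2 * E) \<le> omega2 f h * 3"
          by (rule mult_left_mono[OF _ omega2_nonneg])
        also have "\<dots> \<le> \<delta> * 3" using h by simp
        finally show ?thesis
          using iterates_estimate[of m p h f x] that h unfolding E_def by simp
      qed
      then have "norm ((T ^^ m) f - (T ^^ p) f) \<le> \<delta> * 3" by (rule norm_bound)
      then show ?thesis using \<open>0 < \<epsilon>\<close> by (simp add: \<delta>_def)
    qed
    then show "\<exists>M. \<forall>m\<ge>M. \<forall>n>m. dist ((T ^^ m) f) ((T ^^ n) f) < \<epsilon>"
      unfolding dist_norm by blast
  qed
qed

section \<open>The limit operator\<close>

definition limit_op :: "(unit_interval \<Rightarrow>\<^sub>C real) \<Rightarrow> (unit_interval \<Rightarrow>\<^sub>C real)"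
  where "limit_op f = lim (\<lambda>m. (T ^^ m) f)"

context
  assumes conv: "convergent (\<lambda>m. (T ^^ m) (e_fun 2))"
begin

lemma iterates_tendsto: "(\<lambda>m. (T ^^ m) f) \<longlonglongrightarrow> limit_op f"
  using iterates_converge[OF conv, of f] unfolding limit_op_def convergent_LIMSEQ_iff .

lemma iterates_tendsto_pointwise: "(\<lambda>m. (T ^^ m) f x) \<longlonglongrightarrow> limit_op f x"
proof -
  have "\<forall>\<^sub>F m in sequentially. dist ((T ^^ m) f x) (limit_op f x) \<le> dist ((T ^^ m) f) (limit_op f)"
    by (simp add: dist_bounded)
  from metric_tendsto_imp_tendsto[OF iterates_tendsto this] show ?thesis .
qed

lemma linear_limit_op: "linear limit_op"
proof
  fix f g c
  note lin = affine_reproducing.linear[OF funpow]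
  have "(\<lambda>m. (T ^^ m) (f + g)) \<longlonglongrightarrow> limit_op f + limit_op g"
    unfolding linear_add[OF lin] by (intro tendsto_add iterates_tendsto)
  then show "limit_op (f + g) = limit_op f + limit_op g"
    using LIMSEQ_unique iterates_tendsto by blast
  have "(\<lambda>m. (T ^^ m) (c *\<^sub>R f)) \<longlonglongrightarrow> c *\<^sub>R limit_op f"
    unfolding linear_scale[OF lin] by (intro tendsto_scaleR tendsto_const iterates_tendsto)
  then show "limit_op (c *\<^sub>R f) = c *\<^sub>R limit_op f"
    using LIMSEQ_unique iterates_tendsto by blast
qed

lemma positive_limit_op: "positive_op limit_op"
  unfolding positive_op_def
proof (intro allI impI)
  fix f :: "unit_interval \<Rightarrow>\<^sub>C real" and x
  assume "\<forall>x. 0 \<le> f x"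
  then have "0 \<le> (T ^^ m) f x" for m
    using affine_reproducing.positive[OF funpow[of m]] unfolding positive_op_def by simp
  then show "0 \<le> limit_op f x"
    using LIMSEQ_le_const[OF iterates_tendsto_pointwise] by blast
qed

lemma limit_estimate:
  assumes "0 < h" "h \<le> 1"
  shows "\<bar>(T ^^ m) f x - limit_op f x\<bar>
    \<le> omega2 f h * (9/4 + 2 / h\<^sup>2 * (limit_op (e_fun 2) x - (T ^^ m) (e_fun 2) x))"
proof -
  have "\<bar>limit_op f x - (T ^^ m) f x\<bar>
    \<le> omega2 f h * (9/4 + 2 / h\<^sup>2 * (limit_op (e_fun 2) x - (T ^^ m) (e_fun 2) x))"
  proof (rule LIMSEQ_le)
    show "(\<lambda>p. \<bar>(T ^^ p) f x - (T ^^ m) f x\<bar>) \<longlonglongrightarrow> \<bar>limit_op f x - (T ^^ m) f x\<bar>"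
      by (intro tendsto_intros iterates_tendsto_pointwise)
    show "(\<lambda>p. omega2 f h * (9/4 + 2 / h\<^sup>2 * ((T ^^ p) (e_fun 2) x - (T ^^ m) (e_fun 2) x)))
      \<longlonglongrightarrow> omega2 f h * (9/4 + 2 / h\<^sup>2 * (limit_op (e_fun 2) x - (T ^^ m) (e_fun 2) x))"
      by (intro tendsto_intros iterates_tendsto_pointwise)
    show "\<exists>N. \<forall>p\<ge>N. \<bar>(T ^^ p) f x - (T ^^ m) f x\<bar>
      \<le> omega2 f h * (9/4 + 2 / h\<^sup>2 * ((T ^^ p) (e_fun 2) x - (T ^^ m) (e_fun 2) x))"
      using iterates_estimate assms by blast
  qed
  then show ?thesis by (simp add: abs_minus_commute)
qed

text \<open>
  These bounds make \<open>h = \<surd>a / 2\<close>, with \<open>a\<close> the difference below, a step size that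
  \<open>limit_estimate\<close> admits unless \<open>a = 0\<close>.
\<close>

lemma defect_bounds:
  "0 \<le> limit_op (e_fun 2) x - (T ^^ m) (e_fun 2) x"
  "limit_op (e_fun 2) x - (T ^^ m) (e_fun 2) x \<le> 1"
proof -
  have bounds: "\<bar>(T ^^ p) (e_fun 2) x\<bar> \<le> 1" for p
  proof -
    interpret Tp: affine_reproducing "T ^^ p" by (rule funpow)
    show ?thesis
      by (rule Tp.abs_le) (simp add: coord_bounds power_le_one)
  qed
  have nonneg: "0 \<le> (T ^^ m) (e_fun 2) x"
    using affine_reproducing.positive[OF funpow[of m]] unfolding positive_op_def by simp
  have "limit_op (e_fun 2) x \<le> 1"
    using bounds by (intro LIMSEQ_le_const2[OF iterates_tendsto_pointwise]) (auto simp: abs_le_iff)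
  then show "limit_op (e_fun 2) x - (T ^^ m) (e_fun 2) x \<le> 1"
    using nonneg by simp
  have "(T ^^ m) (e_fun 2) x \<le> limit_op (e_fun 2) x"
    using iterates_mono[OF supporting_lines_square, of "e_fun 2" m]
    by (intro LIMSEQ_le_const[OF iterates_tendsto_pointwise]) auto
  then show "0 \<le> limit_op (e_fun 2) x - (T ^^ m) (e_fun 2) x" by simp
qed

text \<open>
  The choice \<open>h = \<surd>a / 2\<close> turns the factor \<open>2 a / h\<^sup>2\<close> into \<open>8\<close>. If \<open>a = 0\<close>, that term vanishes
  for every \<open>h\<close>, and \<open>\<omega>\<^sub>2(f,h)\<close> can be made arbitrarily small.
\<close>

lemma limit_estimate_omega2:
  "\<bar>(T ^^ m) f x - limit_op f x\<bar>
    \<le> 41/4 * omega2 f (1/2 * sqrt \<bar>limit_op (e_fun 2) x - (T ^^ m) (e_fun 2) x\<bar>)"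
proof -
  define a where "a = limit_op (e_fun 2) x - (T ^^ m) (e_fun 2) x"
  have a: "0 \<le> a" "a \<le> 1" using defect_bounds by (auto simp: a_def)
  show ?thesis
  proof (cases "a = 0")
    case True
    have "\<bar>(T ^^ m) f x - limit_op f x\<bar> \<le> 0"
    proof (rule field_le_epsilon)
      fix \<epsilon> :: real
      assume "0 < \<epsilon>"
      then obtain h where h: "0 < h" "h \<le> 1" "omega2 f h \<le> \<epsilon> / 3"
        using omega2_small[of "\<epsilon> / 3"] by auto
      have "\<bar>(T ^^ m) f x - limit_op f x\<bar> \<le> omega2 f h * (9/4)"
        using limit_estimate[OF h(1,2), of m f x] True by (simp add: a_def)
      then show "\<bar>(T ^^ m) f x - limit_op f x\<bar> \<le> 0 + \<epsilon>"
        using h(3) \<open>0 < \<epsilon>\<close> by simp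
    qed
    then show ?thesis using omega2_nonneg order_trans by fastforce
  next
    case False
    define h where "h = 1/2 * sqrt a"
    have h: "0 < h" "h \<le> 1" "h\<^sup>2 = a / 4"
      using a False real_sqrt_le_mono[of a 4] by (auto simp: h_def power_mult_distrib power2_eq_square)
    have "2 / h\<^sup>2 * a = 8" unfolding h(3) using False by simp
    then have "\<bar>(T ^^ m) f x - limit_op f x\<bar> \<le> omega2 f h * (9/4 + 8)"
      using limit_estimate[OF h(1,2), of m f x] unfolding a_def[symmetric] by simp
    then show ?thesis using a unfolding a_def[symmetric] by (simp add: h_def)
  qed
qed

end

end

theorem theorem3:
  shows "\<exists>k::real. k > 0 \<and>
    (\<forall>(T :: (unit_interval \<Rightarrow>\<^sub>C real) \<Rightarrow> (unit_interval \<Rightarrow>\<^sub>C real)) (L :: unit_interval \<Rightarrow>\<^sub>C real).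
      linear T \<longrightarrow> positive_op T \<longrightarrow>
      T (e_fun 0) = e_fun 0 \<longrightarrow> (\<forall>x. T (e_fun 1) x = coord x) \<longrightarrow>
      (\<lambda>m. norm ((T ^^ m) (e_fun 2) - L)) \<longlonglongrightarrow> 0 \<longrightarrow>
      (\<exists>Tinf :: (unit_interval \<Rightarrow>\<^sub>C real) \<Rightarrow> (unit_interval \<Rightarrow>\<^sub>C real).
        linear Tinf \<and> positive_op Tinf \<and> Tinf (e_fun 2) = L \<and>
        (\<forall>(m::nat) (x::unit_interval) (f :: unit_interval \<Rightarrow>\<^sub>C real).
          \<bar>(T ^^ m) f x - Tinf f x\<bar>
            \<le> k * omega2 f (1 / 2 * sqrt \<bar>Tinf (e_fun 2) x - (T ^^ m) (e_fun 2) x\<bar>))))"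
proof (intro exI[of _ "41/4"] conjI allI impI)
  fix T :: "(unit_interval \<Rightarrow>\<^sub>C real) \<Rightarrow> (unit_interval \<Rightarrow>\<^sub>C real)" and L :: "unit_interval \<Rightarrow>\<^sub>C real"
  assume T: "linear T" "positive_op T" "T (e_fun 0) = e_fun 0" "\<forall>x. T (e_fun 1) x = coord x"
    and L: "(\<lambda>m. norm ((T ^^ m) (e_fun 2) - L)) \<longlonglongrightarrow> 0"
  interpret affine_reproducing T
  proof (rule affine_reproducing.intro)
    show "T (e_fun 1) = e_fun 1" by (rule bcontfun_eqI) (use T(4) in simp)
  qed (use T in auto)
  have lim: "(\<lambda>m. (T ^^ m) (e_fun 2)) \<longlonglongrightarrow> L"
    using L by (metis tendsto_norm_zero_iff LIM_zero_cancel)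
  then have conv: "convergent (\<lambda>m. (T ^^ m) (e_fun 2))" by (rule convergentI)
  show "\<exists>Tinf. linear Tinf \<and> positive_op Tinf \<and> Tinf (e_fun 2) = L \<and>
        (\<forall>m x f. \<bar>(T ^^ m) f x - Tinf f x\<bar>
            \<le> 41/4 * omega2 f (1 / 2 * sqrt \<bar>Tinf (e_fun 2) x - (T ^^ m) (e_fun 2) x\<bar>))"
    using linear_limit_op[OF conv] positive_limit_op[OF conv] limit_estimate_omega2[OF conv]
      limI[OF lim, folded limit_op_def] by blast
qed simp

end
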